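(* For any positive integer $n$, the following equality holds: $$\int_0^1 \frac{dr}{\sqrt{1-r^{2n}}} = 2^{1/n} \int_0^1 \sqrt[2n]{1-x^{2n}}\, dx .$$
   Context: The left-hand integral is an improper integral at $r=1$. Here $\sqrt[2n]{\cdot}$ denotes the nonnegative real $2n$-th root. *)

theory Defs imports "HOL-Analysis.Analysis" begin

text \<open>The integral of \<open>f\<close> over \<open>[a, b)\<close>, improper at the right endpoint \<open>b\<close>, converges to \<open>I\<close>.
  The value of \<open>f\<close> at \<open>b\<close> itself (and beyond) is irrelevant.\<close>

definition has_improper_integral_right ::
  "(real \<Rightarrow> real) \<Rightarrow> real \<Rightarrow> real \<Rightarrow> real \<Rightarrow> bool" where
  "has_improper_integral_right f a b I \<longleftrightarrow>
     (\<forall>t. a \<le> t \<and> t < b \<longrightarrow> f integrable_on {a..t}) \<and>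
     ((\<lambda>t. integral {a..t} f) \<longlongrightarrow> I) (at_left b)"

end

theory Submission imports Defs begin

text \<open>
  Put \<open>m = 2 n\<close> and let \<open>F z\<close> be the area below the curve \<open>x\<^sup>m + y\<^sup>m = 1\<close> over \<open>[0, z]\<close>.
  The integrand on the left has an explicit antiderivative in terms of \<open>F\<close>; for the circle
  \<open>m = 2\<close> this is the fact that the arcsine measures the area of a sector.

  To \<open>t \<in> [0, 1]\<close> attach the point \<open>(X, Y)\<close> of the curve, \<open>X \<le> Y\<close>, with
  \<open>X Y = t / 2 powr (2 / m)\<close>.  Since \<open>X\<^sup>m + Y\<^sup>m = 1\<close> and \<open>X\<^sup>m Y\<^sup>m = t\<^sup>m / 4\<close>, the two powers are
  the roots \<open>(1 \<plusminus> w) / 2\<close> of a quadratic, with \<open>w = sqrt (1 - t\<^sup>m)\<close>; this is where the integrand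
  comes from.  The curve is symmetric in its coordinates, so \<open>F\<close> has derivative \<open>Y\<close> at \<open>X\<close> and
  derivative \<open>X\<close> at \<open>Y\<close>, and hence
  \[ (F(X) - F(Y))' = Y X' - X Y'. \]
  The right-hand side is twice the rate at which the segment from the origin to the point sweeps
  out area.  It equals \<open>1 / (2 powr (2 / m) * w)\<close>
  (\<open>fermat_area_difference_has_derivative\<close>).  As \<open>t\<close> runs from \<open>0\<close> to \<open>1\<close>,
  the point runs from \<open>(0, 1)\<close> to the diagonal, so \<open>F X - F Y\<close> increases from \<open>- F 1\<close> to \<open>0\<close>,
  and \<open>F 1\<close> is the integral on the right.  The argument works for every exponent \<open>m > 0\<close>.
\<close>

definition fermat_height :: "nat \<Rightarrow> real \<Rightarrow> real" where
  "fermat_height m x = root m (1 - x ^ m)"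

definition fermat_area :: "nat \<Rightarrow> real \<Rightarrow> real" where
  "fermat_area m z = integral {0..z} (fermat_height m)"

definition fermat_X :: "nat \<Rightarrow> real \<Rightarrow> real" where
  "fermat_X m t = root m ((1 - sqrt (1 - t ^ m)) / 2)"

definition fermat_Y :: "nat \<Rightarrow> real \<Rightarrow> real" where
  "fermat_Y m t = root m ((1 + sqrt (1 - t ^ m)) / 2)"

lemma continuous_on_fermat_height: "continuous_on A (fermat_height m)"
  unfolding fermat_height_def by (intro continuous_intros)

lemma fermat_area_has_derivative_within:
  assumes "z \<in> {0..1}"
  shows "(fermat_area m has_real_derivative fermat_height m z) (at z within {0..1})"
  unfolding fermat_area_def
  by (rule integral_has_real_derivative[OF continuous_on_fermat_height assms])

lemma continuous_on_fermat_area: "continuous_on {0..1} (fermat_area m)"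
  by (rule DERIV_continuous_on) (rule fermat_area_has_derivative_within)

lemma fermat_area_has_derivative:
  assumes "0 < z" "z < 1"
  shows "(fermat_area m has_real_derivative fermat_height m z) (at z)"
  using fermat_area_has_derivative_within[of z m] assms
  by (simp add: at_within_Icc_at)

lemma fermat_X_power: "m > 0 \<Longrightarrow> 0 \<le> t \<Longrightarrow> t \<le> 1 \<Longrightarrow>
    fermat_X m t ^ m = (1 - sqrt (1 - t ^ m)) / 2"
  unfolding fermat_X_def by (rule real_root_pow_pos2) auto

lemma fermat_Y_power: "m > 0 \<Longrightarrow> 0 \<le> t \<Longrightarrow> t \<le> 1 \<Longrightarrow>
    fermat_Y m t ^ m = (1 + sqrt (1 - t ^ m)) / 2"
  unfolding fermat_Y_def by (rule real_root_pow_pos2) (auto simp: power_le_one)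

text \<open>Both identities say that \<open>(X, Y)\<close> lies on the curve; the second one uses that the curve is
  symmetric in its coordinates.\<close>

lemma
  assumes "m > 0" "0 \<le> t" "t \<le> 1"
  shows fermat_height_X: "fermat_height m (fermat_X m t) = fermat_Y m t"
    and fermat_height_Y: "fermat_height m (fermat_Y m t) = fermat_X m t"
proof -
  have "1 - fermat_X m t ^ m = (1 + sqrt (1 - t ^ m)) / 2"
       "1 - fermat_Y m t ^ m = (1 - sqrt (1 - t ^ m)) / 2"
    using assms by (simp_all add: fermat_X_power fermat_Y_power field_simps)
  then show "fermat_height m (fermat_X m t) = fermat_Y m t"
       "fermat_height m (fermat_Y m t) = fermat_X m t"
    unfolding fermat_height_def by (simp_all only: fermat_X_def fermat_Y_def)
qed

text \<open>The constant is what makes the two sides agree after raising to the power \<open>m\<close>: its \<open>m\<close>-th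
  power is \<open>4\<close>, and \<open>X\<^sup>m Y\<^sup>m = (1 - w) (1 + w) / 4 = t\<^sup>m / 4\<close>.\<close>

lemma fermat_X_mult_Y:
  assumes "m > 0" "0 \<le> t" "t \<le> 1"
  shows "2 powr (2 / real m) * (fermat_X m t * fermat_Y m t) = t"
proof -
  let ?w = "sqrt (1 - t ^ m)"
  have w: "?w\<^sup>2 = 1 - t ^ m" using assms by (simp add: power_le_one)
  have "(2 powr (2 / real m) :: real) ^ m = 4"
    using assms by (simp add: powr_power)
  moreover have "(fermat_X m t * fermat_Y m t) ^ m = (1 - ?w) / 2 * ((1 + ?w) / 2)"
    using assms by (simp only: power_mult_distrib fermat_X_power fermat_Y_power)
  moreover have "(1 - ?w) / 2 * ((1 + ?w) / 2) = t ^ m / 4"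
    using w by (simp add: field_simps power2_eq_square)
  ultimately have "(2 powr (2 / real m) * (fermat_X m t * fermat_Y m t)) ^ m = t ^ m"
    by (simp add: power_mult_distrib)
  moreover have "fermat_X m t \<ge> 0" "fermat_Y m t \<ge> 0"
    using assms by (auto simp: fermat_X_def fermat_Y_def power_le_one)
  ultimately show ?thesis
    using assms by (intro power_eq_imp_eq_base[of _ m t]) auto
qed

lemma fermat_X_bounds: "m > 0 \<Longrightarrow> 0 \<le> t \<Longrightarrow> t \<le> 1 \<Longrightarrow> fermat_X m t \<in> {0..1}"
  using real_sqrt_ge_zero[of "1 - t ^ m"]
  by (simp add: fermat_X_def power_le_one del: real_sqrt_ge_0_iff)

lemma fermat_Y_bounds: "m > 0 \<Longrightarrow> 0 \<le> t \<Longrightarrow> t \<le> 1 \<Longrightarrow> fermat_Y m t \<in> {0..1}"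
  by (auto simp: fermat_Y_def power_le_one)

lemma
  assumes "m > 0" "0 < t" "t < 1"
  shows fermat_X_interior: "0 < fermat_X m t" "fermat_X m t < 1"
    and fermat_Y_interior: "0 < fermat_Y m t" "fermat_Y m t < 1"
proof -
  define w where "w = sqrt (1 - t ^ m)"
  have "0 < w" "w < 1"
    using assms by (auto simp: w_def power_less_one_iff)
  then show "0 < fermat_X m t" "fermat_X m t < 1" "0 < fermat_Y m t" "fermat_Y m t < 1"
    using assms(1) by (simp_all add: fermat_X_def fermat_Y_def flip: w_def)
qed

lemma continuous_on_fermat_X: "continuous_on A (fermat_X m)"
  unfolding fermat_X_def by (intro continuous_intros) auto

lemma continuous_on_fermat_Y: "continuous_on A (fermat_Y m)"
  unfolding fermat_Y_def by (intro continuous_intros) auto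

text \<open>The quantity \<open>m D = - w' / 2\<close> is the derivative of \<open>X\<^sup>m\<close>; since \<open>X\<^sup>m + Y\<^sup>m\<close> is constant,
  \<open>Y\<^sup>m\<close> has the opposite one.\<close>

lemma
  assumes "m > 0" "0 < t" "t < 1"
  defines "D \<equiv> t ^ (m - 1) / (4 * sqrt (1 - t ^ m))"
  shows fermat_X_has_derivative:
      "(fermat_X m has_real_derivative D / fermat_X m t ^ (m - 1)) (at t)"
    and fermat_Y_has_derivative:
      "(fermat_Y m has_real_derivative - D / fermat_Y m t ^ (m - 1)) (at t)"
proof -
  have w: "0 < sqrt (1 - t ^ m)" "sqrt (1 - t ^ m) < 1" and "1 - t ^ m > 0"
    using assms by (auto simp: power_less_one_iff)
  have dw: "((\<lambda>t. sqrt (1 - t ^ m)) has_real_derivative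
      - (real m * t ^ (m - 1) / (2 * sqrt (1 - t ^ m)))) (at t)"
    using \<open>1 - t ^ m > 0\<close>
    by (auto intro!: derivative_eq_intros simp: field_simps)
  have dX: "((\<lambda>t. (1 - sqrt (1 - t ^ m)) / 2) has_real_derivative real m * D) (at t)"
    using DERIV_cdivide[OF DERIV_diff[OF DERIV_const dw], of 1 2] by (simp add: D_def)
  have dY: "((\<lambda>t. (1 + sqrt (1 - t ^ m)) / 2) has_real_derivative - (real m * D)) (at t)"
    using DERIV_cdivide[OF DERIV_add[OF DERIV_const dw], of 1 2] by (simp add: D_def)
  show "(fermat_X m has_real_derivative D / fermat_X m t ^ (m - 1)) (at t)"
    using DERIV_chain2[OF DERIV_real_root[of m "(1 - sqrt (1 - t ^ m)) / 2"] dX] w assms(1)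
    unfolding fermat_X_def[abs_def] by (simp add: field_simps)
  show "(fermat_Y m has_real_derivative - D / fermat_Y m t ^ (m - 1)) (at t)"
    using DERIV_chain2[OF DERIV_real_root[of m "(1 + sqrt (1 - t ^ m)) / 2"] dY] w assms(1)
    unfolding fermat_Y_def[abs_def] by (simp add: field_simps)
qed

text \<open>Up to the constant, the derivative is \<open>Y X' - X Y'\<close>.  Because \<open>X\<close> and \<open>Y\<close> enter it with the
  denominators \<open>X\<^bsup>m-1\<^esup>\<close> and \<open>Y\<^bsup>m-1\<^esup>\<close>, putting it over a common denominator produces
  \<open>(X\<^sup>m + Y\<^sup>m) / (X Y)\<^bsup>m-1\<^esup>\<close>, in which the numerator is \<open>1\<close> and the denominator is a multiple
  of \<open>t\<^bsup>m-1\<^esup>\<close>.\<close>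

lemma fermat_area_difference_has_derivative:
  assumes "m > 0" "0 < t" "t < 1"
  shows "((\<lambda>t. 2 powr (2 / real m) * (fermat_area m (fermat_X m t) - fermat_area m (fermat_Y m t)))
           has_real_derivative 1 / sqrt (1 - t ^ m)) (at t)"
proof -
  let ?X = "fermat_X m t" and ?Y = "fermat_Y m t" and ?k = "2 powr (2 / real m) :: real"
  define w where "w = sqrt (1 - t ^ m)"
  define D where "D = t ^ (m - 1) / (4 * w)"
  have "w > 0"
    using assms by (auto simp: w_def power_less_one_iff)
  have pos: "?X > 0" "?Y > 0"
    using assms by (auto simp: fermat_X_interior fermat_Y_interior)
  have k4: "?k * ?k ^ (m - 1) = 4"
    using assms power_minus_mult[of m ?k] by (simp add: powr_power mult.commute)
  have t: "?k * (?X * ?Y) = t"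
    using assms by (intro fermat_X_mult_Y) auto
  have "?X ^ m + ?Y ^ m = 1"
    using assms by (simp add: fermat_X_power fermat_Y_power add_divide_distrib[symmetric])
  then have sum: "?X * ?X ^ (m - 1) + ?Y * ?Y ^ (m - 1) = 1"
    using assms(1) by (simp flip: power_Suc)
  have X: "((\<lambda>t. fermat_area m (fermat_X m t)) has_real_derivative
      ?Y * (D / ?X ^ (m - 1))) (at t)"
    using DERIV_chain2[OF fermat_area_has_derivative[OF fermat_X_interior[OF assms], of m]
        fermat_X_has_derivative[OF assms]] assms
    by (simp only: fermat_height_X less_imp_le D_def w_def)
  have Y: "((\<lambda>t. fermat_area m (fermat_Y m t)) has_real_derivative
      ?X * (- D / ?Y ^ (m - 1))) (at t)"
    using DERIV_chain2[OF fermat_area_has_derivative[OF fermat_Y_interior[OF assms], of m]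
        fermat_Y_has_derivative[OF assms]] assms
    by (simp only: fermat_height_Y less_imp_le D_def w_def)
  have common_denominator: "k * (y * (d / a) - x * (- d / b)) = k * d * (x * a + y * b) / (a * b)"
    if "a \<noteq> 0" "b \<noteq> 0" for a b d k x y :: real
    using that by (simp add: field_simps)
  have "?k * (?Y * (D / ?X ^ (m - 1)) - ?X * (- D / ?Y ^ (m - 1)))
      = ?k * D * (?X * ?X ^ (m - 1) + ?Y * ?Y ^ (m - 1)) / (?X ^ (m - 1) * ?Y ^ (m - 1))"
    using pos by (intro common_denominator) auto
  also have "\<dots> = ?k * D / (?X * ?Y) ^ (m - 1)"
    by (simp only: sum power_mult_distrib mult_1_right)
  also have "\<dots> = ?k * ?k ^ (m - 1) * (?X * ?Y) ^ (m - 1) / (4 * w) / (?X * ?Y) ^ (m - 1)"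
    unfolding D_def by (subst t[symmetric]) (simp add: power_mult_distrib mult_ac)
  also have "\<dots> = 1 / w"
    using pos \<open>w > 0\<close> k4 by simp
  finally have eq: "?k * (?Y * (D / ?X ^ (m - 1)) - ?X * (- D / ?Y ^ (m - 1))) = 1 / w" .
  show ?thesis
    using DERIV_cmult[OF DERIV_diff[OF X Y], of ?k] unfolding eq w_def .
qed

text \<open>The antiderivative is continuous on all of \<open>[0, 1]\<close>, so the improper integral is the
  difference of its values at the endpoints.\<close>

theorem has_improper_integral_fermat:
  assumes "m > 0"
  shows "has_improper_integral_right (\<lambda>r. 1 / sqrt (1 - r ^ m)) 0 1
           (2 powr (2 / real m) * integral {0..1} (\<lambda>x. root m (1 - x ^ m)))"
proof -
  define J where "J t = 2 powr (2 / real m) *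
    (fermat_area m (fermat_X m t) - fermat_area m (fermat_Y m t))" for t
  have contJ: "continuous_on {0..1} J"
    unfolding J_def using assms fermat_X_bounds fermat_Y_bounds
    by (intro continuous_intros continuous_on_compose2[OF continuous_on_fermat_area]
          continuous_on_fermat_X continuous_on_fermat_Y) auto
  have int: "((\<lambda>r. 1 / sqrt (1 - r ^ m)) has_integral (J t - J 0)) {0..t}"
    if "0 \<le> t" "t < 1" for t
    \<comment> \<open>At \<open>0\<close> the map \<open>fermat_X m\<close> is the root of a quantity that vanishes there, so the chain
      rule is available only in the interior.\<close>
  proof (rule fundamental_theorem_of_calculus_interior)
    show "continuous_on {0..t} J"
      using contJ by (rule continuous_on_subset) (use that in auto)
    show "(J has_vector_derivative 1 / sqrt (1 - x ^ m)) (at x)" if "x \<in> {0<..<t}" for x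
      using fermat_area_difference_has_derivative[OF assms, of x] that \<open>t < 1\<close>
      unfolding J_def[abs_def] has_real_derivative_iff_has_vector_derivative by auto
  qed (use that in auto)
  have "J 1 - J 0 = 2 powr (2 / real m) * fermat_area m 1"
    using assms
    by (simp add: J_def fermat_X_def fermat_Y_def fermat_area_def zero_power algebra_simps)
  moreover have "(J \<longlongrightarrow> J 1) (at_left 1)"
    using contJ by (simp add: continuous_on_Icc_at_leftD)
  ultimately have "((\<lambda>t. J t - J 0) \<longlongrightarrow> 2 powr (2 / real m) * fermat_area m 1) (at_left 1)"
    using tendsto_diff[OF _ tendsto_const, of J "J 1" "at_left 1" "J 0"] by simp
  moreover have "\<forall>\<^sub>F t in at_left 1. J t - J 0 = integral {0..t} (\<lambda>r. 1 / sqrt (1 - r ^ m))"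
    using eventually_at_left_real[of 0 "1::real"]
    by (auto elim!: eventually_mono simp: integral_unique[OF int])
  ultimately have "((\<lambda>t. integral {0..t} (\<lambda>r. 1 / sqrt (1 - r ^ m)))
      \<longlongrightarrow> 2 powr (2 / real m) * fermat_area m 1) (at_left 1)"
    by (rule Lim_transform_eventually)
  then show ?thesis
    using int unfolding has_improper_integral_right_def fermat_area_def fermat_height_def[abs_def]
    by blast
qed

theorem theorem1:
  fixes n :: nat
  assumes "n > 0"
  shows "has_improper_integral_right (\<lambda>r. 1 / sqrt (1 - r ^ (2 * n))) 0 1
           (2 powr (1 / real n) * integral {0..1} (\<lambda>x. root (2 * n) (1 - x ^ (2 * n))))"
  using has_improper_integral_fermat[of "2 * n"] assms by simp

end
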